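(* Let $(X,\mathcal T)$ be a topological space, and let $\mathcal T_l$ be the topology on $X$ having the family of all $\mathcal T$-locally closed subsets of $X$ as a base. Then $(X,\mathcal T)$ is a locally indiscrete space if and only if $\mathcal T=\mathcal T_l$.
   Context: No separation axioms are assumed. A space is locally indiscrete if every open set is closed (equivalently, every closed set is open). A subset $A$ of a topological space $X$ is locally closed if for every $x\in A$ there is an open set $U\subseteq X$ such that $x\in U$ and $A\cap U$ is closed in $U$ (equivalently, $A$ is the intersection of an open set and a closed set). Finite intersections of locally closed sets are locally closed, so the $\mathcal T$-locally closed sets form a base for a topology $\mathcal T_l\supseteq\mathcal T$ on $X$. *)

theory Defs
  imports "HOL-Analysis.Analysis"
begin

definition locally_indiscrete_space :: "'a topology \<Rightarrow> bool" where
  "locally_indiscrete_space X \<longleftrightarrow> (\<forall>U. openin X U \<longrightarrow> closedin X U)"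

definition locally_closedin :: "'a topology \<Rightarrow> 'a set \<Rightarrow> bool" where
  "locally_closedin X A \<longleftrightarrow>
     A \<subseteq> topspace X \<and>
     (\<forall>x\<in>A. \<exists>U. openin X U \<and> x \<in> U \<and> closedin (subtopology X U) (A \<inter> U))"

text \<open>Since \<open>topology\<close> is only meaningful on families satisfying \<open>istopology\<close>,
  \<open>openin_locally_closed_topology\<close> below is needed to see that this is the topology with
  the locally closed sets as a base.\<close>

definition locally_closed_topology :: "'a topology \<Rightarrow> 'a topology" where
  "locally_closed_topology X = topology (arbitrary union_of (locally_closedin X))"

lemma locally_closedin_Int:
  assumes "locally_closedin X A" "locally_closedin X B"
  shows "locally_closedin X (A \<inter> B)"
  unfolding locally_closedin_def
proof (intro conjI ballI)
  show "A \<inter> B \<subseteq> topspace X"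
    using assms by (auto simp: locally_closedin_def)
next
  fix x assume "x \<in> A \<inter> B"
  then obtain U V where U: "openin X U" "x \<in> U" "closedin (subtopology X U) (A \<inter> U)"
    and V: "openin X V" "x \<in> V" "closedin (subtopology X V) (B \<inter> V)"
    using assms unfolding locally_closedin_def by (meson IntD1 IntD2)
  obtain C D where C: "closedin X C" "A \<inter> U = C \<inter> U" and D: "closedin X D" "B \<inter> V = D \<inter> V"
    using U(3) V(3) by (auto simp: closedin_subtopology)
  have "A \<inter> B \<inter> (U \<inter> V) = (C \<inter> D) \<inter> (U \<inter> V)"
    using C D by blast
  then have "closedin (subtopology X (U \<inter> V)) (A \<inter> B \<inter> (U \<inter> V))"
    using C D by (auto simp: closedin_subtopology)
  then show "\<exists>W. openin X W \<and> x \<in> W \<and> closedin (subtopology X W) (A \<inter> B \<inter> W)"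
    using U V by (meson IntI openin_Int)
qed

lemma openin_locally_closed_topology:
  "openin (locally_closed_topology X) = arbitrary union_of (locally_closedin X)"
  unfolding locally_closed_topology_def
  by (intro topology_inverse' istopology_base locally_closedin_Int)

lemma openin_imp_locally_closedin:
  assumes "openin X U"
  shows "locally_closedin X U"
  unfolding locally_closedin_def
proof (intro conjI ballI)
  show "U \<subseteq> topspace X"
    using assms by (rule openin_subset)
  fix x assume "x \<in> U"
  moreover have "closedin (subtopology X U) (U \<inter> U)"
    by (metis Int_absorb assms closedin_topspace openin_subset topspace_subtopology_subset)
  ultimately show "\<exists>W. openin X W \<and> x \<in> W \<and> closedin (subtopology X W) (U \<inter> W)"
    using assms by blast
qed

lemma topspace_locally_closed_topology [simp]:
  "topspace (locally_closed_topology X) = topspace X"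
proof
  show "topspace (locally_closed_topology X) \<subseteq> topspace X"
    unfolding topspace_def[of "locally_closed_topology X"] openin_locally_closed_topology
    by (fastforce simp: union_of_def locally_closedin_def)
  have "openin (locally_closed_topology X) (topspace X)"
    by (simp add: openin_locally_closed_topology openin_imp_locally_closedin
        arbitrary_union_of_inc)
  then show "topspace X \<subseteq> topspace (locally_closed_topology X)"
    by (rule openin_subset)
qed

end

theory Submission
  imports Defs
begin

text \<open>The topology generated by the locally closed sets contains every open set and every
  closed set of \<open>X\<close>. If it is no finer than \<open>X\<close>, then closed sets are open, and passing to
  complements yields local indiscreteness. Conversely, a locally closed set is near each of
  its points the trace of a closed set on an open set; when closed sets are open, such a
  trace is an open neighbourhood, so locally closed sets are open and their unions add
  nothing to \<open>X\<close>.\<close>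

lemma closedin_imp_locally_closedin:
  assumes "closedin X C"
  shows "locally_closedin X C"
  unfolding locally_closedin_def
proof (intro conjI ballI)
  show "C \<subseteq> topspace X"
    using assms by (rule closedin_subset)
  fix x assume "x \<in> C"
  then show "\<exists>U. openin X U \<and> x \<in> U \<and> closedin (subtopology X U) (C \<inter> U)"
    using assms closedin_subset[OF assms]
    by (intro exI[of _ "topspace X"]) (auto simp: Int_absorb2)
qed

lemma locally_indiscrete_space_iff_closedin_imp_openin:
  "locally_indiscrete_space X \<longleftrightarrow> (\<forall>C. closedin X C \<longrightarrow> openin X C)"
  unfolding locally_indiscrete_space_def
  by (metis closedin_def openin_closedin_eq openin_closedin)

lemma locally_closedin_imp_openin:
  assumes "locally_indiscrete_space X" "locally_closedin X A"
  shows "openin X A"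
proof (subst openin_subopen, intro ballI)
  fix x assume "x \<in> A"
  then obtain U where U: "openin X U" "x \<in> U" "closedin (subtopology X U) (A \<inter> U)"
    using assms(2) by (auto simp: locally_closedin_def)
  then obtain C where "closedin X C" "A \<inter> U = C \<inter> U"
    by (auto simp: closedin_subtopology)
  then have "openin X (A \<inter> U)"
    using assms(1) U(1) by (simp add: locally_indiscrete_space_iff_closedin_imp_openin openin_Int)
  then show "\<exists>T. openin X T \<and> x \<in> T \<and> T \<subseteq> A"
    using \<open>x \<in> A\<close> U(2) by blast
qed

theorem proposition3p4:
  fixes X :: "'a topology"
  shows "locally_indiscrete_space X \<longleftrightarrow> X = locally_closed_topology X"
proof
  assume "locally_indiscrete_space X"
  then have "locally_closedin X = openin X"
    by (auto simp: fun_eq_iff intro: locally_closedin_imp_openin openin_imp_locally_closedin)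
  then have "openin (locally_closed_topology X) = arbitrary union_of (openin X)"
    by (simp add: openin_locally_closed_topology)
  also have "\<dots> = openin X"
    by (auto simp: fun_eq_iff union_of_def arbitrary_def)
  finally show "X = locally_closed_topology X"
    by (simp add: topology_eq)
next
  assume eq: "X = locally_closed_topology X"
  have "openin (locally_closed_topology X) C" if "closedin X C" for C
    using that by (simp add: openin_locally_closed_topology closedin_imp_locally_closedin
        arbitrary_union_of_inc)
  with eq show "locally_indiscrete_space X"
    by (simp add: locally_indiscrete_space_iff_closedin_imp_openin)
qed

end
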